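(* Let $V_J$ be a finite-dimensional real Hilbert space with an orthogonal decomposition into approximation and detail spaces $V$ and $W$, with linear operators $\Pi_V:V_J\to V$, $\Pi_W:V_J\to W$ satisfying $\Pi_V\Pi_V^*=\mathrm{Id}_V$, $\Pi_W\Pi_W^*=\mathrm{Id}_W$ and $\Pi_V^*\Pi_V+\Pi_W^*\Pi_W=\mathrm{Id}_{V_J}$. Let $A:V_J\to V_J$ be linear, $\mathbf{z}\in V_J$, $\lambda_a,\lambda_d>0$, $0<\tau<2/\|A^*A\|$, and let $g_a$ on $V$ and $g_d$ on $W$ have single-valued proximity operators $\operatorname{prox}_{\tau\lambda_a g_a}$, $\operatorname{prox}_{\tau\lambda_d g_d}$. Consider the following two algorithms started from the same $(a^0,d^0)\in V\times W$. Block-coordinate algorithm: for $n=0,1,\dots$ $$a^{n+1}=a^n+\varepsilon_{a,n}\big(\operatorname{prox}_{\tau\lambda_a g_a}(a^n-\tau\Pi_VA^*[A(\Pi_V^*a^n+\Pi_W^*d^n)-\mathbf{z}])-a^n\big),$$ $$d^{n+1}=d^n+\varepsilon_{d,n}\big(\operatorname{prox}_{\tau\lambda_d g_d}(d^n-\tau\Pi_WA^*[A(\Pi_V^*a^n+\Pi_W^*d^n)-\mathbf{z}])-d^n\big).$$ Two-level algorithm: for $n=0,1,\dots$, with $A_H=A\Pi_V^*$ and $v_H$ the first-order coherence term at the current iterate $(a^n,d^n)$ (see context), $$a^{n+1/2}=\operatorname{prox}_{\tau\lambda_a g_a}\big(a^n-\tau A_H^*(A_Ha^n-\Pi_V^*\Pi_V\mathbf{z})-\tau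 v_H\big),$$ $$a^{n+1}=\operatorname{prox}_{\tau\lambda_a g_a}\big(a^{n+1/2}-\tau\Pi_VA^*(A(\Pi_V^*a^{n+1/2}+\Pi_W^*d^n)-\mathbf{z})\big),$$ $$d^{n+1}=\operatorname{prox}_{\tau\lambda_d g_d}\big(d^n-\tau\Pi_WA^*(A(\Pi_V^*a^{n+1/2}+\Pi_W^*d^n)-\mathbf{z})\big).$$ Then the two-level algorithm is equivalent to the block-coordinate algorithm with the choice $\varepsilon_{a,2n}=1$, $\varepsilon_{d,2n}=0$, $\varepsilon_{a,2n+1}=1$, $\varepsilon_{d,2n+1}=1$ for all $n\in\mathbb{N}$; that is, for every $n\in\mathbb{N}$, the two-level iterate $(a^n,d^n)$ coincides with the block-coordinate iterate of index $2n$, and the two-level pair $(a^{n+1/2},d^n)$ coincides with the block-coordinate iterate of index $2n+1$.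
   Context: $\operatorname{prox}_{\tau h}(x)=\operatorname{Argmin}_u\frac1{2\tau}\|u-x\|^2+h(u)$. The problem being solved is the minimization over $V\times W$ of $\Psi(a,d)=\frac12\|A(\Pi_V^*a+\Pi_W^*d)-\mathbf{z}\|^2+\lambda_ag_a(a)+\lambda_dg_d(d)$. The coarse function on $V$ is $\Psi_H(a)=\frac12\|A_Ha-\Pi_V^*\Pi_V\mathbf{z}\|^2+\lambda_ag_a(a)+\langle v_H,a\rangle$, with $A_H=A\Pi_V^*$. First-order coherence term: let $g_{a,\mu},g_{d,\mu}$ be differentiable functions (smoothings of $g_a,g_d$ with the same smoothing technique and the same parameter $\mu>0$ at both levels), and set $\Psi_\mu(a,d)=\frac12\|A(\Pi_V^*a+\Pi_W^*d)-\mathbf{z}\|^2+\lambda_ag_{a,\mu}(a)+\lambda_dg_{d,\mu}(d)$ and $\Psi_{H,\mu}(a)=\frac12\|A_Ha-\Pi_V^*\Pi_V\mathbf{z}\|^2+\lambda_ag_{a,\mu}(a)$. With $R_V(a,d)=a$ the restriction onto $V$, the term at $(a^n,d^n)$ is $v_H=R_V\nabla\Psi_\mu(a^n,d^n)-\nabla\Psi_{H,\mu}(a^n)$. *)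

theory Defs
  imports "HOL-Analysis.Analysis"
begin

text \<open>
  The spaces are arbitrary types of class \<open>real_inner\<close> rather than \<open>euclidean_space\<close>, because the
  latter class excludes the zero space and hence the trivial decompositions.
\<close>

definition finite_dimensional :: "'a::real_vector itself \<Rightarrow> bool" where
  "finite_dimensional _ \<longleftrightarrow> (\<exists>B. finite B \<and> span B = (UNIV :: 'a set))"

definition prox_objective ::
  "real \<Rightarrow> ('a::real_inner \<Rightarrow> ereal) \<Rightarrow> 'a \<Rightarrow> 'a \<Rightarrow> ereal" where
  "prox_objective \<tau> h x u = ereal (1 / (2 * \<tau>) * (norm (u - x))\<^sup>2) + h u"

definition prox_single_valued :: "real \<Rightarrow> ('a::real_inner \<Rightarrow> ereal) \<Rightarrow> bool" where
  "prox_single_valued \<tau> h \<longleftrightarrow> (\<forall>x. \<exists>!u. is_arg_min (prox_objective \<tau> h x) (\<lambda>_. True) u)"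

text \<open>The minimizer; meaningful only when \<open>prox_single_valued \<tau> h\<close> holds.\<close>

definition prox :: "real \<Rightarrow> ('a::real_inner \<Rightarrow> ereal) \<Rightarrow> 'a \<Rightarrow> 'a" where
  "prox \<tau> h x = arg_min (prox_objective \<tau> h x) (\<lambda>_. True)"

definition grad :: "('a::real_inner \<Rightarrow> real) \<Rightarrow> 'a \<Rightarrow> 'a" where
  "grad f x = (THE D. GDERIV f x :> D)"

text \<open>
  Below, \<open>PV\<close> and \<open>PW\<close> are the operators \<open>\<Pi>\<^sub>V\<close> and \<open>\<Pi>\<^sub>W\<close>, and \<open>sa\<close>, \<open>sd\<close> are the
  smoothed functions \<open>g\<^sub>a\<^sub>,\<^sub>\<mu>\<close>, \<open>g\<^sub>d\<^sub>,\<^sub>\<mu>\<close>. Both levels use the same \<open>sa\<close>, which is how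
  the common smoothing technique and parameter enter.
\<close>

definition Psi_smooth ::
  "('j::real_inner \<Rightarrow> 'j) \<Rightarrow> ('j \<Rightarrow> 'v::real_inner) \<Rightarrow> ('j \<Rightarrow> 'w::real_inner) \<Rightarrow> 'j \<Rightarrow>
   real \<Rightarrow> real \<Rightarrow> ('v \<Rightarrow> real) \<Rightarrow> ('w \<Rightarrow> real) \<Rightarrow> 'v \<times> 'w \<Rightarrow> real" where
  "Psi_smooth A PV PW z la ld sa sd = (\<lambda>(a, d).
     1 / 2 * (norm (A (adjoint PV a + adjoint PW d) - z))\<^sup>2 + la * sa a + ld * sd d)"

definition coarse_op :: "('j::real_inner \<Rightarrow> 'j) \<Rightarrow> ('j \<Rightarrow> 'v::real_inner) \<Rightarrow> 'v \<Rightarrow> 'j" where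
  "coarse_op A PV = A \<circ> adjoint PV"

definition Psi_coarse_smooth ::
  "('j::real_inner \<Rightarrow> 'j) \<Rightarrow> ('j \<Rightarrow> 'v::real_inner) \<Rightarrow> 'j \<Rightarrow> real \<Rightarrow> ('v \<Rightarrow> real) \<Rightarrow> 'v \<Rightarrow> real" where
  "Psi_coarse_smooth A PV z la sa a =
     1 / 2 * (norm (coarse_op A PV a - adjoint PV (PV z)))\<^sup>2 + la * sa a"

text \<open>The restriction \<open>(a, d) \<mapsto> a\<close> onto \<open>V\<close> is \<open>fst\<close>.\<close>

definition coherence_term ::
  "('j::real_inner \<Rightarrow> 'j) \<Rightarrow> ('j \<Rightarrow> 'v::real_inner) \<Rightarrow> ('j \<Rightarrow> 'w::real_inner) \<Rightarrow> 'j \<Rightarrow>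
   real \<Rightarrow> real \<Rightarrow> ('v \<Rightarrow> real) \<Rightarrow> ('w \<Rightarrow> real) \<Rightarrow> 'v \<Rightarrow> 'w \<Rightarrow> 'v" where
  "coherence_term A PV PW z la ld sa sd a d =
     fst (grad (Psi_smooth A PV PW z la ld sa sd) (a, d)) - grad (Psi_coarse_smooth A PV z la sa) a"

end

theory Submission
  imports Defs
begin

text \<open>
  The coherence term replaces the gradient of the coarse data fit at the current iterate by the
  \<open>V\<close>-component of the gradient of the fine one; the smoothed regularizers cancel because both
  levels use the same \<open>sa\<close>. Hence the coarse step is a step of the
  block-coordinate algorithm that freezes \<open>d\<close>.
\<close>

section \<open>Linear maps and adjoints on a finite-dimensional inner product space\<close>

text \<open>Gram-Schmidt yields a finite orthogonal spanning set, on which both sides agree as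
  linear maps. This stands in for coordinates, since the spaces are only of class
  \<open>real_inner\<close>.\<close>

lemma linear_orthogonal_expansion:
  assumes "finite_dimensional TYPE('a::real_inner)"
  obtains C :: "'a::real_inner set" where "finite C"
    "\<And>(f :: 'a::real_inner \<Rightarrow> 'b::real_vector) x. linear f \<Longrightarrow>
      f x = (\<Sum>c\<in>C. (x \<bullet> c / (c \<bullet> c)) *\<^sub>R f c)"
proof -
  obtain B :: "'a set" where B: "finite B" "span B = UNIV"
    using assms by (auto simp: finite_dimensional_def)
  obtain C :: "'a set" where C: "finite C" "span C = UNIV" "pairwise orthogonal C"
    using basis_orthogonal[OF B(1)] B(2) by auto
  have "f x = (\<Sum>c\<in>C. (x \<bullet> c / (c \<bullet> c)) *\<^sub>R f c)" if f: "linear f" for f :: "'a \<Rightarrow> 'b" and x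
  proof (rule linear_eq_on_span[OF f, where B = C])
    show "linear (\<lambda>x. \<Sum>c\<in>C. (x \<bullet> c / (c \<bullet> c)) *\<^sub>R f c)"
      by (rule linearI)
        (simp_all add: inner_add_left add_divide_distrib scaleR_add_left sum.distrib scaleR_sum_right)
    show "f b = (\<Sum>c\<in>C. (b \<bullet> c / (c \<bullet> c)) *\<^sub>R f c)" if b: "b \<in> C" for b
    proof -
      \<comment> \<open>Orthogonality kills every term but \<open>c = b\<close>. The set
        \<open>C\<close> may contain 0: for \<open>b = 0\<close> the coefficient is
        \<open>0 / 0 = 0\<close>, which fits because \<open>f 0 = 0\<close>.\<close>
      have "(\<Sum>c\<in>C. (b \<bullet> c / (c \<bullet> c)) *\<^sub>R f c) = (\<Sum>c\<in>C. if c = b then f b else 0)"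
        using C(3) b linear_0[OF f]
        by (intro sum.cong) (auto simp: pairwise_def orthogonal_def)
      then show ?thesis
        using b C(1) by simp
    qed
    show "x \<in> span C"
      using C(2) by simp
  qed
  with C(1) show thesis
    using that by blast
qed

lemma bounded_linear_finite_dimensional:
  fixes f :: "'a::real_inner \<Rightarrow> 'b::real_normed_vector"
  assumes fd: "finite_dimensional TYPE('a)" and f: "linear f"
  shows "bounded_linear f"
proof -
  obtain C :: "'a set" where
    "\<And>(g :: 'a \<Rightarrow> 'b) x. linear g \<Longrightarrow> g x = (\<Sum>c\<in>C. (x \<bullet> c / (c \<bullet> c)) *\<^sub>R g c)"
    using linear_orthogonal_expansion[OF fd] by metis
  then have "f = (\<lambda>x. \<Sum>c\<in>C. (x \<bullet> c / (c \<bullet> c)) *\<^sub>R f c)"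
    using f by blast
  moreover have "bounded_linear (\<lambda>x. \<Sum>c\<in>C. (x \<bullet> c / (c \<bullet> c)) *\<^sub>R f c)"
    unfolding divide_inverse
    by (intro bounded_linear_sum bounded_linear_scaleR_const bounded_linear_mult_const
        bounded_linear_inner_left)
  ultimately show ?thesis
    by simp
qed

text \<open>\<open>adjoint\<close> is defined by choice, so its characteristic equation has to be
  backed by a witness, which the orthogonal expansion of the domain provides.\<close>

lemma adjoint_inner:
  fixes f :: "'a::real_inner \<Rightarrow> 'b::real_inner"
  assumes fd: "finite_dimensional TYPE('a)" and f: "linear f"
  shows "f x \<bullet> y = x \<bullet> adjoint f y"
proof -
  obtain C :: "'a set" where
    C: "\<And>(g :: 'a \<Rightarrow> 'b) x. linear g \<Longrightarrow> g x = (\<Sum>c\<in>C. (x \<bullet> c / (c \<bullet> c)) *\<^sub>R g c)"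
    using linear_orthogonal_expansion[OF fd] by metis
  \<comment> \<open>Pairing the expansion of \<open>f x\<close> with \<open>y\<close> and collecting
    the factors \<open>x \<bullet> c\<close> gives this vector.\<close>
  define g where "g y = (\<Sum>c\<in>C. (f c \<bullet> y / (c \<bullet> c)) *\<^sub>R c)" for y
  have g: "f x \<bullet> y = x \<bullet> g y" for x y
    by (subst C[OF f]) (simp add: g_def inner_sum_left inner_sum_right mult.commute)
  then have "adjoint f = g"
    by (intro adjoint_unique) blast
  with g show ?thesis
    by simp
qed

lemma linear_if_inner_adjoint:
  assumes "\<And>x y. f x \<bullet> y = x \<bullet> g y"
  shows "linear g"
  by (rule linearI; rule vector_eq_ldot[THEN iffD1])
    (simp_all add: inner_add_right flip: assms)

text \<open>The norm is preserved:
  \<open>g x \<bullet> g x = f (g x) \<bullet> x = x \<bullet> x\<close>. This serves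
  \<open>adjoint PV\<close> and \<open>adjoint PW\<close>, whose domains get their finite dimension
  only indirectly, through \<open>'j\<close>.\<close>

lemma bounded_linear_isometry:
  assumes fg: "\<And>x y. f x \<bullet> y = x \<bullet> g y" and id: "f \<circ> g = id"
  shows "bounded_linear g"
proof (rule bounded_linear_intro[where K = 1])
  have "linear g"
    using fg by (rule linear_if_inner_adjoint)
  then show "g (x + y) = g x + g y" "g (r *\<^sub>R x) = r *\<^sub>R g x" for x y r
    by (simp_all add: linear_add linear_scale)
  have "g x \<bullet> g x = x \<bullet> x" for x
    using fg[of "g x" x] id by (simp add: pointfree_idE)
  then show "norm (g x) \<le> norm x * 1" for x
    by (simp add: norm_eq_sqrt_inner)
qed

section \<open>Gradients\<close>

text \<open>\<open>grad\<close> is a definite description; uniqueness holds because the derivative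
  is unique and the functional \<open>h \<bullet> E\<close> determines \<open>E\<close>.\<close>

lemma GDERIV_grad: "GDERIV f x :> D \<Longrightarrow> grad f x = D"
  unfolding grad_def
proof (rule the_equality)
  fix E assume "GDERIV f x :> D" "GDERIV f x :> E"
  then have "(\<lambda>h. h \<bullet> E) = (\<lambda>h. h \<bullet> D)"
    unfolding gderiv_def by (rule has_derivative_unique[rotated])
  then show "E = D"
    by (metis vector_eq_ldot)
qed

text \<open>The product rule gives the derivative
  \<open>h \<mapsto> L h \<bullet> (L x - z)\<close>, and \<open>adj\<close> moves \<open>L\<close>
  across. The adjoint is a parameter \<open>L'\<close>, so that explicit formulas can be supplied on
  \<open>V\<close> and on the product space.\<close>

lemma GDERIV_least_squares:
  assumes L: "bounded_linear L" and adj: "\<And>x y. L x \<bullet> y = x \<bullet> L' y"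
  shows "GDERIV (\<lambda>x. 1 / 2 * (norm (L x - z))\<^sup>2) x :> L' (L x - z)"
proof -
  have "((\<lambda>x. L x - z) has_derivative L) (at x)"
    using has_derivative_diff[OF bounded_linear_imp_has_derivative[OF L] has_derivative_const]
    by simp
  from has_derivative_mult_right[OF has_derivative_inner[OF this this], of "1 / 2"]
  show ?thesis
    by (simp add: gderiv_def power2_norm_eq_inner inner_commute flip: adj)
qed

text \<open>Riesz representation on a space that a finite-dimensional space is mapped onto.\<close>

lemma GDERIV_ex_if_coisometry:
  fixes P :: "'j::real_inner \<Rightarrow> 'v::real_inner"
  assumes fd: "finite_dimensional TYPE('j)" and P: "linear P" and id: "P \<circ> adjoint P = id"
    and s: "(s :: 'v \<Rightarrow> real) differentiable (at a)"
  obtains k where "GDERIV s a :> k"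
proof -
  obtain D where D: "(s has_derivative D) (at a)"
    using s by (auto simp: differentiable_def)
  then have "linear (D \<circ> P)"
    using P by (simp add: linear_compose has_derivative_linear)
  \<comment> \<open>The functional \<open>D\<close> is pulled back along \<open>P\<close> to
    \<open>'j\<close>, where it is represented by \<open>r = adjoint (D \<circ> P) 1\<close>. Then
    \<open>D x = D (P (adjoint P x)) = adjoint P x \<bullet> r = x \<bullet> P r\<close>.\<close>
  from adjoint_inner[OF fd this, of _ 1] adjoint_inner[OF fd P]
  have "D x = x \<bullet> P (adjoint (D \<circ> P) 1)" for x
    using id by (metis comp_apply id_apply inner_commute inner_real_def mult.right_neutral)
  then have "D = (\<lambda>x. x \<bullet> P (adjoint (D \<circ> P) 1))"
    by blast
  with D have "GDERIV s a :> P (adjoint (D \<circ> P) 1)"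
    by (simp add: gderiv_def)
  then show thesis
    by (rule that)
qed

section \<open>The coarse operator and the coherence term\<close>

text \<open>The adjoint relations of \<open>A\<close> and \<open>P\<close>, both maps out of
  \<open>'j\<close>, are chained; the resulting pairing identity then determines the
  adjoint.\<close>

lemma adjoint_coarse_op:
  assumes fd: "finite_dimensional TYPE('j::real_inner)" and A: "linear (A :: 'j \<Rightarrow> 'j)"
    and P: "linear P"
  shows "coarse_op A P x \<bullet> y = x \<bullet> P (adjoint A y)"
    and "adjoint (coarse_op A P) = P \<circ> adjoint A"
proof -
  show *: "coarse_op A P x \<bullet> y = x \<bullet> P (adjoint A y)" for x y
    using adjoint_inner[OF fd A] adjoint_inner[OF fd P]
    by (metis coarse_op_def comp_apply inner_commute)
  then show "adjoint (coarse_op A P) = P \<circ> adjoint A"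
    by (intro adjoint_unique) simp
qed

text \<open>Both smoothed objectives are differentiated explicitly. \<open>fst\<close> discards the
  \<open>W\<close>-component of the fine gradient, and \<open>la *\<^sub>R ka\<close> occurs in both
  gradients and cancels.\<close>

lemma coherence_term_eq:
  fixes A :: "'j::real_inner \<Rightarrow> 'j"
    and PV :: "'j \<Rightarrow> 'v::real_inner"
    and PW :: "'j \<Rightarrow> 'w::real_inner"
  assumes fd: "finite_dimensional TYPE('j)"
    and linear: "linear A" "linear PV" "linear PW"
    and coiso: "PV \<circ> adjoint PV = id" "PW \<circ> adjoint PW = id"
    and smooth: "sa differentiable (at a)" "sd differentiable (at d)"
  shows "coherence_term A PV PW z la ld sa sd a d =
    PV (adjoint A (A (adjoint PV a + adjoint PW d) - z))
    - adjoint (coarse_op A PV) (coarse_op A PV a - adjoint PV (PV z))"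
proof -
  note adjV = adjoint_inner[OF fd linear(2)] and adjW = adjoint_inner[OF fd linear(3)]
  obtain ka where ka: "GDERIV sa a :> ka"
    using GDERIV_ex_if_coisometry[OF fd linear(2) coiso(1) smooth(1)] .
  obtain kd where kd: "GDERIV sd d :> kd"
    using GDERIV_ex_if_coisometry[OF fd linear(3) coiso(2) smooth(2)] .
  note blA = bounded_linear_finite_dimensional[OF fd linear(1)]
  note blV = bounded_linear_isometry[OF adjV coiso(1)]
  note blW = bounded_linear_isometry[OF adjW coiso(2)]
  \<comment> \<open>The fine forward operator on the product space, split into one block per factor
    so that boundedness and the adjoint follow blockwise.\<close>
  define L where "L = (\<lambda>p. coarse_op A PV (fst p) + coarse_op A PW (snd p))"
  have L: "L (b, e) = A (adjoint PV b + adjoint PW e)" for b e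
    using linear(1) by (simp add: L_def coarse_op_def linear_add)
  have blHV: "bounded_linear (coarse_op A PV)" and blHW: "bounded_linear (coarse_op A PW)"
    unfolding coarse_op_def comp_def
    by (intro bounded_linear_compose[OF blA] blV blW)+
  have blL: "bounded_linear L"
    unfolding L_def
    by (intro bounded_linear_add bounded_linear_compose[OF blHV] bounded_linear_compose[OF blHW]
        bounded_linear_fst bounded_linear_snd)
  have adjL: "L p \<bullet> y = p \<bullet> (PV (adjoint A y), PW (adjoint A y))" for p y
    by (cases p) (simp add: L_def inner_add_left adjoint_coarse_op(1)[OF fd linear(1)] linear)
  have sa: "((\<lambda>p. sa (fst p)) has_derivative (\<lambda>h. fst h \<bullet> ka)) (at (a, d))"
    using ka unfolding gderiv_def
    by (intro has_derivative_compose[where f = fst and g = sa]) (auto intro: derivative_eq_intros)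
  have sd: "((\<lambda>p. sd (snd p)) has_derivative (\<lambda>h. snd h \<bullet> kd)) (at (a, d))"
    using kd unfolding gderiv_def
    by (intro has_derivative_compose[where f = snd and g = sd]) (auto intro: derivative_eq_intros)
  let ?r = "A (adjoint PV a + adjoint PW d) - z"
  have Psi: "Psi_smooth A PV PW z la ld sa sd =
      (\<lambda>p. 1 / 2 * (norm (L p - z))\<^sup>2 + la * sa (fst p) + ld * sd (snd p))"
    by (auto simp: Psi_smooth_def L)
  \<comment> \<open>The derivative is a sum of pairings with \<open>h\<close>, \<open>fst h\<close>
    and \<open>snd h\<close>; the inner product of the product space merges them into one pairing
    with a pair.\<close>
  have "GDERIV (Psi_smooth A PV PW z la ld sa sd) (a, d) :>
      (PV (adjoint A ?r) + la *\<^sub>R ka, PW (adjoint A ?r) + ld *\<^sub>R kd)"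
    using has_derivative_add[OF has_derivative_add[OF
        GDERIV_least_squares[OF blL adjL, unfolded gderiv_def]
        has_derivative_mult_right[OF sa, of la]] has_derivative_mult_right[OF sd, of ld]]
    by (simp add: Psi gderiv_def L inner_prod_def inner_add_right add_ac)
  then have fine: "grad (Psi_smooth A PV PW z la ld sa sd) (a, d) =
      (PV (adjoint A ?r) + la *\<^sub>R ka, PW (adjoint A ?r) + ld *\<^sub>R kd)"
    by (rule GDERIV_grad)
  have "GDERIV (Psi_coarse_smooth A PV z la sa) a :>
      PV (adjoint A (coarse_op A PV a - adjoint PV (PV z))) + la *\<^sub>R ka"
    using has_derivative_add[OF GDERIV_least_squares[OF blHV
          adjoint_coarse_op(1)[OF fd linear(1,2)], unfolded gderiv_def]
        has_derivative_mult_right[OF ka[unfolded gderiv_def], of la]]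
    by (simp add: Psi_coarse_smooth_def[abs_def] gderiv_def inner_add_right)
  then have "grad (Psi_coarse_smooth A PV z la sa) a =
      PV (adjoint A (coarse_op A PV a - adjoint PV (PV z))) + la *\<^sub>R ka"
    by (rule GDERIV_grad)
  with fine show ?thesis
    by (simp add: coherence_term_def adjoint_coarse_op(2)[OF fd linear(1,2)])
qed

section \<open>Matching the iterates of the two algorithms\<close>

theorem proposition4p2:
  fixes A :: "'j::real_inner \<Rightarrow> 'j"
    and PV :: "'j \<Rightarrow> 'v::real_inner"
    and PW :: "'j \<Rightarrow> 'w::real_inner"
    and z :: 'j
    and la ld \<tau> \<mu> :: real
    and ga :: "'v \<Rightarrow> ereal" and gd :: "'w \<Rightarrow> ereal"
    and ga_smooth :: "real \<Rightarrow> 'v \<Rightarrow> real" and gd_smooth :: "real \<Rightarrow> 'w \<Rightarrow> real"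
    and a0 :: 'v and d0 :: 'w
    and epsa epsd :: "nat \<Rightarrow> real"
    and a_bc a_ml a_half :: "nat \<Rightarrow> 'v"
    and d_bc d_ml :: "nat \<Rightarrow> 'w"
  assumes finite_dim: "finite_dimensional TYPE('j)"
    and linear: "linear A" "linear PV" "linear PW"
    and decomposition:
      "PV \<circ> adjoint PV = id"
      "PW \<circ> adjoint PW = id"
      "\<And>x. adjoint PV (PV x) + adjoint PW (PW x) = x"
    and lambda_pos: "la > 0" "ld > 0"
    and step_size: "0 < \<tau>" "ereal \<tau> < 2 / ereal (onorm (adjoint A \<circ> A))"
    and no_minus_infinity: "\<And>a. ga a \<noteq> - \<infinity>" "\<And>d. gd d \<noteq> - \<infinity>"
    and prox_ga: "prox_single_valued \<tau> (\<lambda>u. ereal la * ga u)"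
    and prox_gd: "prox_single_valued \<tau> (\<lambda>u. ereal ld * gd u)"
    and mu_pos: "\<mu> > 0"
    and smooth:
      "\<And>a. ga_smooth \<mu> differentiable (at a)"
      "\<And>d. gd_smooth \<mu> differentiable (at d)"
    and block_coordinate_init: "a_bc 0 = a0" "d_bc 0 = d0"
    and block_coordinate_a: "\<And>n. a_bc (Suc n) = a_bc n + epsa n *\<^sub>R
      (prox \<tau> (\<lambda>u. ereal la * ga u)
         (a_bc n - \<tau> *\<^sub>R PV (adjoint A (A (adjoint PV (a_bc n) + adjoint PW (d_bc n)) - z)))
       - a_bc n)"
    and block_coordinate_d: "\<And>n. d_bc (Suc n) = d_bc n + epsd n *\<^sub>R
      (prox \<tau> (\<lambda>u. ereal ld * gd u)
         (d_bc n - \<tau> *\<^sub>R PW (adjoint A (A (adjoint PV (a_bc n) + adjoint PW (d_bc n)) - z)))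
       - d_bc n)"
    and two_level_init: "a_ml 0 = a0" "d_ml 0 = d0"
    and two_level_half: "\<And>n. a_half n =
      prox \<tau> (\<lambda>u. ereal la * ga u)
        (a_ml n
         - \<tau> *\<^sub>R adjoint (coarse_op A PV) (coarse_op A PV (a_ml n) - adjoint PV (PV z))
         - \<tau> *\<^sub>R coherence_term A PV PW z la ld (ga_smooth \<mu>) (gd_smooth \<mu>) (a_ml n) (d_ml n))"
    and two_level_a: "\<And>n. a_ml (Suc n) =
      prox \<tau> (\<lambda>u. ereal la * ga u)
        (a_half n - \<tau> *\<^sub>R PV (adjoint A (A (adjoint PV (a_half n) + adjoint PW (d_ml n)) - z)))"
    and two_level_d: "\<And>n. d_ml (Suc n) =
      prox \<tau> (\<lambda>u. ereal ld * gd u)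
        (d_ml n - \<tau> *\<^sub>R PW (adjoint A (A (adjoint PV (a_half n) + adjoint PW (d_ml n)) - z)))"
    and eps_choice:
      "\<And>n. epsa (2 * n) = 1" "\<And>n. epsd (2 * n) = 0"
      "\<And>n. epsa (2 * n + 1) = 1" "\<And>n. epsd (2 * n + 1) = 1"
  shows "\<forall>n. (a_ml n, d_ml n) = (a_bc (2 * n), d_bc (2 * n)) \<and>
             (a_half n, d_ml n) = (a_bc (2 * n + 1), d_bc (2 * n + 1))"
proof -
  \<comment> \<open>The coarse data-fit gradient cancels against its negative in the coherence term,
    leaving a fine proximal gradient step in \<open>a\<close> with \<open>d\<close> fixed.\<close>
  have half: "a_half n = prox \<tau> (\<lambda>u. ereal la * ga u)
      (a_ml n - \<tau> *\<^sub>R PV (adjoint A (A (adjoint PV (a_ml n) + adjoint PW (d_ml n)) - z)))" for n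
    using two_level_half[of n]
    by (simp add: coherence_term_eq[OF finite_dim linear decomposition(1,2) smooth] scaleR_diff_right)
  \<comment> \<open>At index \<open>2 * n\<close>, \<open>epsa = 1\<close> turns the relaxed update
    into the plain prox and \<open>epsd = 0\<close> keeps \<open>d\<close>. The conditional form
    serves both the induction step and the final conclusion.\<close>
  have odd: "a_half n = a_bc (2 * n + 1) \<and> d_ml n = d_bc (2 * n + 1)"
    if "a_ml n = a_bc (2 * n)" "d_ml n = d_bc (2 * n)" for n
    using that half[of n] block_coordinate_a[of "2 * n"] block_coordinate_d[of "2 * n"]
      eps_choice(1,2)[of n]
    by simp
  have even: "a_ml n = a_bc (2 * n) \<and> d_ml n = d_bc (2 * n)" for n
  proof (induction n)
    case 0
    then show ?case
      using block_coordinate_init two_level_init by simp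
  next
    case (Suc n)
    \<comment> \<open>\<open>2 * Suc n\<close> is the successor of \<open>2 * n + 1\<close>. Both
      \<open>two_level_a\<close> and \<open>two_level_d\<close> evaluate the residual at
      \<open>(a_half n, d_ml n)\<close>, the block-coordinate iterate of index
      \<open>2 * n + 1\<close>, so they match the simultaneous update with both relaxation
      parameters 1.\<close>
    then show ?case
      using odd[of n] two_level_a[of n] two_level_d[of n] block_coordinate_a[of "2 * n + 1"]
        block_coordinate_d[of "2 * n + 1"] eps_choice(3,4)[of n]
      by simp
  qed
  with odd show ?thesis
    by blast
qed

end
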